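(* Let $\mathfrak{g}$ be a Leibniz algebra over an arbitrary field of characteristic different from two. The following assertions are equivalent: (i) $\mathfrak{g}$ is quasi-Artinian. (ii) There exists $m\in\mathbb{N}$ such that for every descending chain of ideals $I_1\supseteq I_2\supseteq\cdots$ of $\mathfrak{g}$, the descending chains $[\mathfrak{g}^{(m)},I_1]\supseteq[\mathfrak{g}^{(m)},I_2]\supseteq\cdots$ and $[I_1,\mathfrak{g}^{(m)}]\supseteq[I_2,\mathfrak{g}^{(m)}]\supseteq\cdots$ of ideals terminate. (iii) For any non-empty collection $\mathcal{C}$ of ideals of $\mathfrak{g}$, there exist $I\in\mathcal{C}$ and $m\in\mathbb{N}$ such that $[\mathfrak{g}^{(m)},I]\subseteq J$ and $[I,\mathfrak{g}^{(m)}]\subseteq J$ for all $J\in\mathcal{C}$ with $J\subseteq I$.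
   Context: A (left) Leibniz algebra is a vector space $\mathfrak{g}$ (of arbitrary dimension) over a field with a bilinear bracket satisfying $[x,[y,z]]=[[x,y],z]+[y,[x,z]]$ for all $x,y,z$. "Ideal" means two-sided ideal. For subspaces $A,B$, $[A,B]$ is the linear span of all $[a,b]$, $a\in A$, $b\in B$. The derived series is $\mathfrak{g}^{(0)}=\mathfrak{g}$, $\mathfrak{g}^{(n+1)}=[\mathfrak{g}^{(n)},\mathfrak{g}^{(n)}]$. $\mathfrak{g}$ is left (resp. right) quasi-Artinian if for every descending chain of ideals $I_1\supseteq I_2\supseteq\cdots$ of $\mathfrak{g}$ there is $m\in\mathbb{N}$ such that $[\mathfrak{g}^{(m)},I_m]\subseteq I_n$ (resp. $[I_m,\mathfrak{g}^{(m)}]\subseteq I_n$) for all $n\in\mathbb{N}$; it is quasi-Artinian if it is both left and right quasi-Artinian. A descending chain terminates if it is eventually constant.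
   Formalization: In (ii), the words "of ideals" for the chains of products are dropped: [g^(m),I_n] is always a subspace but need not be a two-sided ideal, even for finite-dimensional g in characteristic 0; only termination of the descending chains of subspaces is asserted. *)

theory Defs
  imports Complex_Main
begin

text \<open>
  The underlying space of the Leibniz algebra is the whole type \<open>'v\<close>, with scalar
  multiplication \<open>scale\<close> by elements of the field \<open>'k\<close>; its dimension is arbitrary.
\<close>

locale leibniz_algebra = vector_space scale
  for scale :: "'k::field \<Rightarrow> 'v::ab_group_add \<Rightarrow> 'v" +
  fixes bracket :: "'v \<Rightarrow> 'v \<Rightarrow> 'v"
  assumes linear_bracket_right: "Vector_Spaces.linear scale scale (\<lambda>y. bracket x y)"
    and linear_bracket_left: "Vector_Spaces.linear scale scale (\<lambda>x. bracket x y)"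
    and left_leibniz:
      "bracket x (bracket y z) = bracket (bracket x y) z + bracket y (bracket x z)"
begin

definition is_ideal :: "'v set \<Rightarrow> bool" where
  "is_ideal I \<longleftrightarrow> subspace I \<and> (\<forall>x. \<forall>a\<in>I. bracket x a \<in> I \<and> bracket a x \<in> I)"

definition product :: "'v set \<Rightarrow> 'v set \<Rightarrow> 'v set" where
  "product A B = span {bracket a b | a b. a \<in> A \<and> b \<in> B}"

primrec derived :: "nat \<Rightarrow> 'v set" where
  "derived 0 = UNIV"
| "derived (Suc n) = product (derived n) (derived n)"

text \<open>Chains are indexed by the positive integers; the value at index 0 is irrelevant.\<close>

definition descending_ideal_chain :: "(nat \<Rightarrow> 'v set) \<Rightarrow> bool" where
  "descending_ideal_chain I \<longleftrightarrow> (\<forall>n\<ge>1. is_ideal (I n)) \<and> (\<forall>n\<ge>1. I (Suc n) \<subseteq> I n)"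

definition terminates :: "(nat \<Rightarrow> 'v set) \<Rightarrow> bool" where
  "terminates X \<longleftrightarrow> (\<exists>N\<ge>1. \<forall>n\<ge>N. X n = X N)"

definition left_quasi_Artinian :: bool where
  "left_quasi_Artinian \<longleftrightarrow>
    (\<forall>I. descending_ideal_chain I \<longrightarrow>
      (\<exists>m\<ge>1. \<forall>n\<ge>1. product (derived m) (I m) \<subseteq> I n))"

definition right_quasi_Artinian :: bool where
  "right_quasi_Artinian \<longleftrightarrow>
    (\<forall>I. descending_ideal_chain I \<longrightarrow>
      (\<exists>m\<ge>1. \<forall>n\<ge>1. product (I m) (derived m) \<subseteq> I n))"

definition quasi_Artinian :: bool where
  "quasi_Artinian \<longleftrightarrow> left_quasi_Artinian \<and> right_quasi_Artinian"

text \<open>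
  The chains of products are descending by monotonicity of \<open>product\<close>. Their members
  need not be ideals (\<open>product (derived m) I\<close> can fail to be a right ideal), so this
  is not part of the condition.
\<close>

definition product_chains_terminate :: bool where
  "product_chains_terminate \<longleftrightarrow>
    (\<exists>m. \<forall>I. descending_ideal_chain I \<longrightarrow>
      terminates (\<lambda>n. product (derived m) (I n)) \<and>
      terminates (\<lambda>n. product (I n) (derived m)))"

definition quasi_minimal_condition :: bool where
  "quasi_minimal_condition \<longleftrightarrow>
    (\<forall>C. C \<noteq> {} \<and> (\<forall>I\<in>C. is_ideal I) \<longrightarrow>
      (\<exists>I\<in>C. \<exists>m. \<forall>J\<in>C. J \<subseteq> I \<longrightarrow>
        product (derived m) I \<subseteq> J \<and> product I (derived m) \<subseteq> J))"

end

end

theory Submission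
  imports Defs
begin

text \<open>
  The implication from (i) to (ii) is the substantial one. Applied to the derived series,
  (i) yields \<open>m\<close> with \<open>P = \<gg>\<^sup>(\<^sup>m\<^sup>)\<close> satisfying \<open>P = [P,P]\<close>. For a chain \<open>I\<close> and large \<open>k\<close>, both
  \<open>[P,I\<^sub>k]\<close> and \<open>[I\<^sub>k,P]\<close> lie in every \<open>I\<^sub>n\<close>, so the Leibniz identity gives
  \<open>[P,I\<^sub>k] \<subseteq> [P,[P,I\<^sub>k]] \<subseteq> [P,I\<^sub>n]\<close>. On the other side,
  \<open>[I\<^sub>k,P] \<subseteq> [[I\<^sub>k,P],P] + [P,[I\<^sub>k,P]]\<close>, where only the second summand is a problem. The left
  annihilator \<open>Z\<close> of the algebra is an ideal containing all \<open>[x,y] + [y,x]\<close>; hence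
  \<open>[I\<^sub>k,P] + Z = [P,I\<^sub>k] + Z\<close> is eventually constant. The intersections \<open>[I\<^sub>n,P] \<inter> Z\<close> are
  ideals, although \<open>[I\<^sub>n,P]\<close> need not be one, so \<open>[P,[I\<^sub>n,P] \<inter> Z]\<close> is eventually constant by
  the left case. Together, \<open>[P,[I\<^sub>n,P]]\<close> is eventually constant.
\<close>

context leibniz_algebra
begin

section \<open>Bilinearity and the Leibniz identity\<close>

lemma bracket_add_right: "bracket x (y + z) = bracket x y + bracket x z"
  using linear_bracket_right unfolding Vector_Spaces.linear_iff by blast

lemma bracket_scale_right: "bracket x (scale c y) = scale c (bracket x y)"
  using linear_bracket_right unfolding Vector_Spaces.linear_iff by blast

lemma bracket_add_left: "bracket (x + y) z = bracket x z + bracket y z"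
  using linear_bracket_left unfolding Vector_Spaces.linear_iff by blast

lemma bracket_scale_left: "bracket (scale c x) y = scale c (bracket x y)"
  using linear_bracket_left unfolding Vector_Spaces.linear_iff by blast

lemma bracket_zero_right [simp]: "bracket x 0 = 0"
  using bracket_add_right[of x 0 0] by simp

lemma bracket_zero_left [simp]: "bracket 0 x = 0"
  using bracket_add_left[of 0 0 x] by simp

lemma bracket_bracket_left:
  "bracket (bracket x y) z = bracket x (bracket y z) - bracket y (bracket x z)"
  using left_leibniz[of x y z] by simp

text \<open>By \<open>bracket_bracket_left\<close>, left multiplication by [x,y] is the commutator
  of the left multiplications by x and y, which changes sign when x and y are swapped.\<close>

lemma bracket_symmetrized_left: "bracket (bracket x y + bracket y x) z = 0"
  by (simp add: bracket_add_left bracket_bracket_left)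

section \<open>Products of subsets and their generators\<close>

lemma subspace_bracket_left_vimage: "subspace S \<Longrightarrow> subspace {x. bracket x y \<in> S}"
  by (auto simp: subspace_def bracket_add_left bracket_scale_left)

lemma subspace_bracket_right_vimage: "subspace S \<Longrightarrow> subspace {y. bracket x y \<in> S}"
  by (auto simp: subspace_def bracket_add_right bracket_scale_right)

lemma subspace_product: "subspace (product A B)"
  unfolding product_def by (rule subspace_span)

lemma bracket_in_product: "a \<in> A \<Longrightarrow> b \<in> B \<Longrightarrow> bracket a b \<in> product A B"
  unfolding product_def by (rule span_base) auto

lemma product_subsetI:
  assumes "subspace S" "\<And>a b. a \<in> A \<Longrightarrow> b \<in> B \<Longrightarrow> bracket a b \<in> S"
  shows "product A B \<subseteq> S"
  unfolding product_def using assms by (intro span_minimal) auto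

lemma product_mono: "A \<subseteq> A' \<Longrightarrow> B \<subseteq> B' \<Longrightarrow> product A B \<subseteq> product A' B'"
  by (rule product_subsetI) (auto intro: subspace_product bracket_in_product)

text \<open>Elements of the inner product are linear combinations of brackets; since the preimage of
  \<open>S\<close> under bracketing with \<open>c\<close> is a subspace, checking single brackets
  suffices.\<close>

lemma product_product_left_subsetI:
  assumes S: "subspace S"
    and gen: "\<And>a b c. a \<in> A \<Longrightarrow> b \<in> B \<Longrightarrow> c \<in> C \<Longrightarrow> bracket (bracket a b) c \<in> S"
  shows "product (product A B) C \<subseteq> S"
proof (rule product_subsetI[OF S])
  fix p c assume "p \<in> product A B" "c \<in> C"
  then show "bracket p c \<in> S"
    using product_subsetI[OF subspace_bracket_left_vimage[OF S, of c], of A B] gen by blast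
qed

lemma product_product_right_subsetI:
  assumes S: "subspace S"
    and gen: "\<And>a b c. a \<in> A \<Longrightarrow> b \<in> B \<Longrightarrow> c \<in> C \<Longrightarrow> bracket a (bracket b c) \<in> S"
  shows "product A (product B C) \<subseteq> S"
proof (rule product_subsetI[OF S])
  fix a p assume "a \<in> A" "p \<in> product B C"
  then show "bracket a p \<in> S"
    using product_subsetI[OF subspace_bracket_right_vimage[OF S, of a], of B C] gen by blast
qed

section \<open>Ideals and the derived series\<close>

lemma is_ideal_subspace: "is_ideal I \<Longrightarrow> subspace I"
  by (simp add: is_ideal_def)

lemma is_ideal_bracket:
  assumes "is_ideal I" "a \<in> I"
  shows "bracket x a \<in> I" "bracket a x \<in> I"
  using assms by (auto simp: is_ideal_def)

lemma product_subset_ideal_right: "is_ideal I \<Longrightarrow> product A I \<subseteq> I"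
  by (rule product_subsetI) (auto simp: is_ideal_subspace is_ideal_bracket)

lemma product_subset_ideal_left: "is_ideal I \<Longrightarrow> product I A \<subseteq> I"
  by (rule product_subsetI) (auto simp: is_ideal_subspace is_ideal_bracket)

text \<open>Left multiplication by \<open>x\<close> is a derivation, so [a,b] goes to [[x,a],b] +
  [a,[x,b]]. Right multiplications need not be derivations, hence the one-sided conclusion.\<close>

lemma bracket_in_product_ideals:
  assumes "is_ideal A" "is_ideal B" "c \<in> product A B"
  shows "bracket x c \<in> product A B"
proof -
  have "product {x} (product A B) \<subseteq> product A B"
    using assms(1,2)
    by (intro product_product_right_subsetI subspace_product, subst left_leibniz)
       (simp add: subspace_add subspace_product bracket_in_product is_ideal_bracket)
  then show ?thesis using assms(3) bracket_in_product by blast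
qed

text \<open>Right multiplication sends [a,b] to [a,[b,x]] - [b,[a,x]]. The second term has its
  factors in the opposite order, which is harmless because both come from \<open>A\<close>.\<close>

lemma is_ideal_product_self:
  assumes "is_ideal A"
  shows "is_ideal (product A A)"
proof -
  have "product (product A A) UNIV \<subseteq> product A A"
    using assms
    by (intro product_product_left_subsetI subspace_product, subst bracket_bracket_left)
       (simp add: subspace_diff subspace_product bracket_in_product is_ideal_bracket)
  then show ?thesis
    using assms bracket_in_product[of _ "product A A" _ UNIV]
    by (auto simp: is_ideal_def[of "product A A"] subspace_product bracket_in_product_ideals)
qed

lemma is_ideal_derived: "is_ideal (derived n)"
  by (induction n) (auto simp: is_ideal_product_self, simp add: is_ideal_def)

lemma derived_antimono: "m \<le> n \<Longrightarrow> derived n \<subseteq> derived m"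
  by (rule lift_Suc_antimono_le[of derived])
     (simp_all add: product_subset_ideal_left is_ideal_derived)

lemma descending_ideal_chain_derived: "descending_ideal_chain derived"
  using is_ideal_derived derived_antimono[of n "Suc n" for n]
  unfolding descending_ideal_chain_def by simp

lemma descending_ideal_chain_ideal: "descending_ideal_chain I \<Longrightarrow> n \<ge> 1 \<Longrightarrow> is_ideal (I n)"
  by (simp add: descending_ideal_chain_def)

lemma descending_ideal_chain_antimono:
  assumes "descending_ideal_chain I" "1 \<le> m" "m \<le> n"
  shows "I n \<subseteq> I m"
  using assms(3)
proof (induction n rule: dec_induct)
  case (step n)
  then have "I (Suc n) \<subseteq> I n"
    using assms(1,2) by (simp add: descending_ideal_chain_def)
  with step.IH show ?case by blast
qed simp

section \<open>The left annihilator\<close>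

definition left_annihilator :: "'v set" where
  "left_annihilator = {z. \<forall>y. bracket z y = 0}"

lemma subspace_left_annihilator: "subspace left_annihilator"
  by (auto simp: subspace_def left_annihilator_def bracket_add_left bracket_scale_left)

lemma symmetrized_in_left_annihilator: "bracket x y + bracket y x \<in> left_annihilator"
  by (simp add: left_annihilator_def bracket_symmetrized_left)

lemma is_ideal_left_annihilator: "is_ideal left_annihilator"
  unfolding is_ideal_def
proof (intro conjI allI ballI)
  fix x a assume a: "a \<in> left_annihilator"
  then have "bracket a x = 0" by (simp add: left_annihilator_def)
  then show "bracket a x \<in> left_annihilator" "bracket x a \<in> left_annihilator"
    using symmetrized_in_left_annihilator[of x a]
    by (simp_all add: subspace_0 subspace_left_annihilator)
qed (rule subspace_left_annihilator)

text \<open>Right multiplication kills the intersection, so only stability under left multiplication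
  remains, and both sets have it.\<close>

lemma is_ideal_product_Int_left_annihilator:
  assumes "is_ideal A" "is_ideal B"
  shows "is_ideal (product A B \<inter> left_annihilator)"
  unfolding is_ideal_def
proof (intro conjI allI ballI)
  fix x a assume a: "a \<in> product A B \<inter> left_annihilator"
  then have "bracket a x = 0" by (simp add: left_annihilator_def)
  then show "bracket a x \<in> product A B \<inter> left_annihilator"
    by (simp add: subspace_0 subspace_product subspace_left_annihilator)
  show "bracket x a \<in> product A B \<inter> left_annihilator"
    using a assms is_ideal_left_annihilator
    by (auto intro: bracket_in_product_ideals is_ideal_bracket)
qed (intro subspace_inter subspace_product subspace_left_annihilator)

text \<open>Modulo the left annihilator the bracket is antisymmetric, so an inclusion between left
  products carries over to right products.\<close>

lemma product_subset_product_flip_plus_left_annihilator: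
  assumes "product B A \<subseteq> product B C"
  shows "product A B \<subseteq> {x + z | x z. x \<in> product C B \<and> z \<in> left_annihilator}"
    (is "_ \<subseteq> ?T")
proof -
  have T: "subspace ?T"
    by (intro subspace_sums subspace_product subspace_left_annihilator)
  have Z: "left_annihilator \<subseteq> ?T" and X: "product C B \<subseteq> ?T"
    using subspace_0[OF subspace_product] subspace_0[OF subspace_left_annihilator] by force+
  have flip: "bracket x y \<in> ?T" if "bracket y x \<in> ?T" for x y
    using subspace_diff[OF T _ that] Z symmetrized_in_left_annihilator[of x y] by fastforce
  have BC: "product B C \<subseteq> ?T"
    by (rule product_subsetI[OF T], rule flip, rule subsetD[OF X], rule bracket_in_product)
  show ?thesis
    by (rule product_subsetI[OF T], rule flip, rule subsetD[OF BC], rule subsetD[OF assms],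
        rule bracket_in_product)
qed

section \<open>Products with a perfect ideal\<close>

lemma product_self_left_subset: "product (product P P) A \<subseteq> product P (product P A)"
  by (intro product_product_left_subsetI subspace_product, subst bracket_bracket_left)
     (auto intro!: subspace_diff subspace_product bracket_in_product)

text \<open>Perfectness rewrites [P,A] as [[P,P],A], which lies in [P,[P,A]] and thus in
  [P,B].\<close>

lemma left_stable_product:
  assumes "product P P = P" "product P A \<subseteq> B"
  shows "product P A \<subseteq> product P B"
  using product_self_left_subset[of P A] product_mono[OF subset_refl assms(2)] assms(1) by force

text \<open>Meant for two members \<open>B\<close> \<subseteq> \<open>A\<close> of a chain, far
  enough along. The hypothesis \<open>ann\<close> is the left case for the chain of intersections
  with the left annihilator.\<close>

lemma right_stable_product:
  assumes P: "product P P = P" "is_ideal P" and A: "is_ideal A" and BA: "B \<subseteq> A"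
    and left: "product P A \<subseteq> B" and right: "product A P \<subseteq> B"
    and ann: "product P (product A P \<inter> left_annihilator) \<subseteq> product B P"
    and B: "is_ideal B"
  shows "product A P \<subseteq> product B P"
proof -
  have step: "product P (product A P) \<subseteq> product B P"
  proof (rule product_subsetI[OF subspace_product])
    fix p x assume p: "p \<in> P" and x: "x \<in> product A P"
    obtain y z where y: "y \<in> product B P" and z: "z \<in> left_annihilator" and xyz: "x = y + z"
      using product_subset_product_flip_plus_left_annihilator[OF left_stable_product[OF P(1) left]] x
      by blast
    \<comment> \<open>The correction term \<open>z\<close> must itself lie in
      \<open>product A P\<close> for \<open>ann\<close> to apply; it does, as the difference of
      \<open>x\<close> and \<open>y\<close>.\<close>
    have "y \<in> product A P"
      using y product_mono[OF BA subset_refl] by blast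
    then have "z \<in> product A P"
      using subspace_diff[OF subspace_product x, of y] xyz by simp
    then have "bracket p z \<in> product B P"
      using p z by (intro subsetD[OF ann] bracket_in_product IntI)
    moreover have "bracket p y \<in> product B P"
      using y by (rule bracket_in_product_ideals[OF B P(2)])
    ultimately show "bracket p x \<in> product B P"
      unfolding xyz bracket_add_right by (intro subspace_add subspace_product)
  qed
  \<comment> \<open>Expand [a,[p,q]] as [[a,p],q] + [p,[a,q]]: \<open>right\<close> handles the
    first term, \<open>step\<close> the second.\<close>
  have "product A (product P P) \<subseteq> product B P"
  proof (rule product_product_right_subsetI[OF subspace_product])
    fix a p q assume apq: "a \<in> A" "p \<in> P" "q \<in> P"
    then have "bracket (bracket a p) q \<in> product B P"
      by (intro bracket_in_product subsetD[OF right])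
    moreover have "bracket p (bracket a q) \<in> product B P"
      using apq by (intro subsetD[OF step] bracket_in_product)
    ultimately show "bracket a (bracket p q) \<in> product B P"
      by (subst left_leibniz) (intro subspace_add subspace_product)
  qed
  then show ?thesis by (simp add: P(1))
qed

section \<open>From (i) to (ii)\<close>

lemma left_quasi_Artinian_derived_stable:
  assumes "left_quasi_Artinian"
  obtains m where "\<And>n. derived m \<subseteq> derived n"
proof -
  obtain m where m: "\<And>n. n \<ge> 1 \<Longrightarrow> product (derived m) (derived m) \<subseteq> derived n"
    using assms descending_ideal_chain_derived unfolding left_quasi_Artinian_def by metis
  \<comment> \<open>The bound concerns [\<open>derived m\<close>, \<open>derived m\<close>], hence
    the shift to \<open>Suc m\<close>. Index 0 lies outside the chain, but \<open>derived 0\<close>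
    is everything.\<close>
  have "derived (Suc m) \<subseteq> derived n" for n
    using m[of n] by (cases "n = 0") auto
  then show ?thesis by (rule that)
qed

lemma terminatesI:
  assumes "\<And>n. n \<ge> N \<Longrightarrow> X n \<subseteq> X N" "\<And>n. n \<ge> N \<Longrightarrow> X N \<subseteq> X n" "N \<ge> 1"
  shows "terminates X"
  unfolding terminates_def using assms by blast

lemma quasi_Artinian_imp_product_chains_terminate:
  assumes "quasi_Artinian"
  shows "product_chains_terminate"
proof -
  have L: "left_quasi_Artinian" and R: "right_quasi_Artinian"
    using assms by (auto simp: quasi_Artinian_def)
  obtain m where m: "\<And>n. derived m \<subseteq> derived n"
    using left_quasi_Artinian_derived_stable[OF L] by blast
  define P where "P = derived m"
  have P_ideal: "is_ideal P"
    by (simp add: P_def is_ideal_derived)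
  have P_perfect: "product P P = P"
    using m[of "Suc m"] product_subset_ideal_left[OF P_ideal] by (auto simp: P_def)
  have left_bound: "\<exists>k\<ge>1. \<forall>N\<ge>k. \<forall>n\<ge>1. product P (I N) \<subseteq> I n"
    if I: "descending_ideal_chain I" for I
  proof -
    obtain k where k: "k \<ge> 1" "\<And>n. n \<ge> 1 \<Longrightarrow> product (derived k) (I k) \<subseteq> I n"
      using L I unfolding left_quasi_Artinian_def by blast
    have "product P (I N) \<subseteq> product (derived k) (I k)" if "N \<ge> k" for N
      unfolding P_def by (intro product_mono m descending_ideal_chain_antimono[OF I] k that)
    then show ?thesis using k by (meson order_trans)
  qed
  have right_bound: "\<exists>k\<ge>1. \<forall>N\<ge>k. \<forall>n\<ge>1. product (I N) P \<subseteq> I n"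
    if I: "descending_ideal_chain I" for I
  proof -
    obtain k where k: "k \<ge> 1" "\<And>n. n \<ge> 1 \<Longrightarrow> product (I k) (derived k) \<subseteq> I n"
      using R I unfolding right_quasi_Artinian_def by blast
    have "product (I N) P \<subseteq> product (I k) (derived k)" if "N \<ge> k" for N
      unfolding P_def by (intro product_mono m descending_ideal_chain_antimono[OF I] k that)
    then show ?thesis using k by (meson order_trans)
  qed
  have "terminates (\<lambda>n. product P (I n)) \<and> terminates (\<lambda>n. product (I n) P)"
    if I: "descending_ideal_chain I" for I
  proof -
    define W where "W n = product (I n) P \<inter> left_annihilator" for n
    have W: "descending_ideal_chain W"
      using I product_mono[OF _ subset_refl, of _ _ P] P_ideal
      unfolding descending_ideal_chain_def W_def
      by (auto simp: is_ideal_product_Int_left_annihilator)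
    obtain k1 where k1: "k1 \<ge> 1" "\<And>N n. N \<ge> k1 \<Longrightarrow> n \<ge> 1 \<Longrightarrow> product P (I N) \<subseteq> I n"
      using left_bound[OF I] by blast
    obtain k2 where k2: "\<And>N n. N \<ge> k2 \<Longrightarrow> n \<ge> 1 \<Longrightarrow> product (I N) P \<subseteq> I n"
      using right_bound[OF I] by blast
    obtain k3 where k3: "\<And>N n. N \<ge> k3 \<Longrightarrow> n \<ge> 1 \<Longrightarrow> product P (W N) \<subseteq> W n"
      using left_bound[OF W] by blast
    define N where "N = max k1 (max k2 k3)"
    have N: "N \<ge> 1" "N \<ge> k1" "N \<ge> k2" "N \<ge> k3"
      using k1 by (auto simp: N_def)
    note antimono = descending_ideal_chain_antimono[OF I N(1)]
    have "terminates (\<lambda>n. product P (I n))"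
    proof (rule terminatesI[OF _ _ N(1)])
      fix n assume n: "n \<ge> N"
      show "product P (I n) \<subseteq> product P (I N)"
        by (intro product_mono subset_refl antimono n)
      show "product P (I N) \<subseteq> product P (I n)"
        using k1 N n by (intro left_stable_product P_perfect) auto
    qed
    moreover have "terminates (\<lambda>n. product (I n) P)"
    proof (rule terminatesI[OF _ _ N(1)])
      fix n assume n: "n \<ge> N"
      show "product (I n) P \<subseteq> product (I N) P"
        by (intro product_mono subset_refl antimono n)
      have n1: "n \<ge> 1" using n N by simp
      show "product (I N) P \<subseteq> product (I n) P"
      proof (rule right_stable_product[OF P_perfect P_ideal])
        \<comment> \<open>The left bound for \<open>W\<close> puts the product inside
          \<open>W n\<close>, which is contained in \<open>product (I n) P\<close> by
          construction.\<close>
        show "product P (product (I N) P \<inter> left_annihilator) \<subseteq> product (I n) P"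
          using k3[OF N(4) n1] by (auto simp: W_def)
      qed (use N n1 n k1 k2 antimono descending_ideal_chain_ideal[OF I] in auto)
    qed
    ultimately show ?thesis ..
  qed
  then show ?thesis
    unfolding product_chains_terminate_def P_def by blast
qed

section \<open>From (ii) to (i)\<close>

lemma product_chains_terminate_imp_quasi_Artinian:
  assumes "product_chains_terminate"
  shows "quasi_Artinian"
proof -
  obtain m where m: "\<And>I. descending_ideal_chain I \<Longrightarrow>
      terminates (\<lambda>n. product (derived m) (I n)) \<and> terminates (\<lambda>n. product (I n) (derived m))"
    using assms unfolding product_chains_terminate_def by blast
  have "(\<exists>k\<ge>1. \<forall>n\<ge>1. product (derived k) (I k) \<subseteq> I n) \<and>
        (\<exists>k\<ge>1. \<forall>n\<ge>1. product (I k) (derived k) \<subseteq> I n)"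
    if I: "descending_ideal_chain I" for I
  proof -
    obtain N1 N2 where N: "N1 \<ge> 1"
        "\<And>n. n \<ge> N1 \<Longrightarrow> product (derived m) (I n) = product (derived m) (I N1)"
        "\<And>n. n \<ge> N2 \<Longrightarrow> product (I n) (derived m) = product (I N2) (derived m)"
      using m[OF I] unfolding terminates_def by blast
    define k where "k = max m (max N1 N2)"
    have k: "k \<ge> 1" "k \<ge> m" "k \<ge> N1" "k \<ge> N2"
      using N(1) by (auto simp: k_def)
    have "product (derived k) (I k) \<subseteq> I n \<and> product (I k) (derived k) \<subseteq> I n" if n: "n \<ge> 1" for n
    proof -
      \<comment> \<open>Beyond \<open>k\<close> both product chains are constant, so
        \<open>I k\<close> may be replaced by the later ideal \<open>I l\<close>, which absorbs
        products and lies in \<open>I n\<close>.\<close>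
      define l where "l = max k n"
      have l: "l \<ge> k" "l \<ge> n" "l \<ge> 1" using n by (auto simp: l_def)
      have ln: "I l \<subseteq> I n"
        by (rule descending_ideal_chain_antimono[OF I n l(2)])
      have Il: "is_ideal (I l)"
        by (rule descending_ideal_chain_ideal[OF I l(3)])
      have "product (derived k) (I k) \<subseteq> product (derived m) (I k)"
        by (intro product_mono derived_antimono k subset_refl)
      also have "\<dots> = product (derived m) (I l)"
        using N(2)[of k] N(2)[of l] k l by simp
      also have "\<dots> \<subseteq> I n"
        using product_subset_ideal_right[OF Il] ln by blast
      finally have left: "product (derived k) (I k) \<subseteq> I n" .
      have "product (I k) (derived k) \<subseteq> product (I k) (derived m)"
        by (intro product_mono derived_antimono k subset_refl)
      also have "\<dots> = product (I l) (derived m)"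
        using N(3)[of k] N(3)[of l] k l by simp
      also have "\<dots> \<subseteq> I n"
        using product_subset_ideal_left[OF Il] ln by blast
      finally show ?thesis using left by blast
    qed
    then show ?thesis using k(1) by blast
  qed
  then show ?thesis
    unfolding quasi_Artinian_def left_quasi_Artinian_def right_quasi_Artinian_def by blast
qed

section \<open>Equivalence of (i) and (iii)\<close>

lemma quasi_Artinian_imp_quasi_minimal_condition:
  assumes "quasi_Artinian"
  shows "quasi_minimal_condition"
proof (rule ccontr)
  assume not_min: "\<not> quasi_minimal_condition"
  define R where "R m I J \<longleftrightarrow> product (derived m) I \<subseteq> J \<and> product I (derived m) \<subseteq> J" for m I J
  obtain C where C: "C \<noteq> {}" "\<And>I. I \<in> C \<Longrightarrow> is_ideal I"
    and bad: "\<And>I m. I \<in> C \<Longrightarrow> \<exists>J. J \<in> C \<and> (J \<subseteq> I \<and> \<not> R m I J)"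
    using not_min unfolding quasi_minimal_condition_def R_def[symmetric] by metis
  \<comment> \<open>Dependent choice lets the derived exponent grow with the position: the step from
    \<open>I n\<close> to its successor defeats exponent \<open>n\<close>, so no single exponent can
    work along the chain.\<close>
  have "\<exists>I. \<forall>n. I n \<in> C \<and> (I (Suc n) \<subseteq> I n \<and> \<not> R n (I n) (I (Suc n)))"
  proof (rule dependent_nat_choice[where P = "\<lambda>_ I. I \<in> C" and Q = "\<lambda>n I J. J \<subseteq> I \<and> \<not> R n I J"])
    show "\<exists>I. I \<in> C" using C(1) by (simp add: ex_in_conv)
  qed (rule bad)
  then obtain I where I: "\<And>n. I n \<in> C" "\<And>n. I (Suc n) \<subseteq> I n"
    and fail: "\<And>n. \<not> R n (I n) (I (Suc n))"
    by metis
  have chain: "descending_ideal_chain I"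
    using I C(2) by (simp add: descending_ideal_chain_def)
  obtain k l where kl: "k \<ge> 1" "l \<ge> 1"
      "\<And>n. n \<ge> 1 \<Longrightarrow> product (derived k) (I k) \<subseteq> I n"
      "\<And>n. n \<ge> 1 \<Longrightarrow> product (I l) (derived l) \<subseteq> I n"
    using assms chain
    unfolding quasi_Artinian_def left_quasi_Artinian_def right_quasi_Artinian_def by metis
  define n where "n = max k l"
  have n: "k \<le> n" "l \<le> n" by (auto simp: n_def)
  have "product (derived n) (I n) \<subseteq> product (derived k) (I k)"
    "product (I n) (derived n) \<subseteq> product (I l) (derived l)"
    by (intro product_mono derived_antimono descending_ideal_chain_antimono[OF chain] kl n)+
  then show False
    using fail[of n] kl(3,4)[of "Suc n"] by (auto simp: R_def)
qed

lemma quasi_minimal_condition_imp_quasi_Artinian: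
  assumes "quasi_minimal_condition"
  shows "quasi_Artinian"
proof -
  have "\<exists>k\<ge>1. \<forall>n\<ge>1. product (derived k) (I k) \<subseteq> I n \<and> product (I k) (derived k) \<subseteq> I n"
    if I: "descending_ideal_chain I" for I
  proof -
    have "I ` {1..} \<noteq> {} \<and> (\<forall>J\<in>I ` {1..}. is_ideal J)"
      using descending_ideal_chain_ideal[OF I] by auto
    from assms[unfolded quasi_minimal_condition_def, rule_format, OF this]
    obtain K m where K: "K \<in> I ` {1..}" and K_min: "\<forall>J\<in>I ` {1..}. J \<subseteq> K \<longrightarrow>
        product (derived m) K \<subseteq> J \<and> product K (derived m) \<subseteq> J"
      by (elim bexE exE)
    obtain i where i: "i \<ge> 1" and Ki: "K = I i"
      using K by auto
    have min: "product (derived m) (I i) \<subseteq> I j \<and> product (I i) (derived m) \<subseteq> I j"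
      if "j \<ge> 1" "I j \<subseteq> I i" for j
      using K_min[rule_format, of "I j"] that unfolding Ki by simp
    \<comment> \<open>Quasi-Artinianity uses one index for both the derived term and the chain
      member, so \<open>i\<close> and \<open>m\<close> are merged.\<close>
    define k where "k = max i m"
    have k: "k \<ge> i" "k \<ge> m" "k \<ge> 1" using i by (auto simp: k_def)
    have sub: "product (derived k) (I k) \<subseteq> product (derived m) (I i)"
      "product (I k) (derived k) \<subseteq> product (I i) (derived m)"
      by (intro product_mono derived_antimono descending_ideal_chain_antimono[OF I] i k)+
    have "product (derived k) (I k) \<subseteq> I n \<and> product (I k) (derived k) \<subseteq> I n" if n: "n \<ge> 1" for n
    proof -
      \<comment> \<open>Minimality only speaks of members below \<open>I i\<close>; for
        \<open>n\<close> < \<open>i\<close> the comparison passes through \<open>I i\<close>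
        itself.\<close>
      have "I (max i n) \<subseteq> I i" and le_n: "I (max i n) \<subseteq> I n"
        by (rule descending_ideal_chain_antimono[OF I], use i n in simp_all)+
      then have "product (derived m) (I i) \<subseteq> I (max i n)"
        "product (I i) (derived m) \<subseteq> I (max i n)"
        using min[of "max i n"] i by simp_all
      with sub le_n show ?thesis by (meson order_trans)
    qed
    then show ?thesis using k(3) by blast
  qed
  then show ?thesis
    unfolding quasi_Artinian_def left_quasi_Artinian_def right_quasi_Artinian_def by blast
qed

end

theorem theorem3p6:
  fixes scale :: "'k::field \<Rightarrow> 'v::ab_group_add \<Rightarrow> 'v"
    and bracket :: "'v \<Rightarrow> 'v \<Rightarrow> 'v"
  assumes "leibniz_algebra scale bracket"
    and "CHAR('k) \<noteq> 2"
  shows "(leibniz_algebra.quasi_Artinian scale bracket \<longleftrightarrow>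
          leibniz_algebra.product_chains_terminate scale bracket) \<and>
         (leibniz_algebra.product_chains_terminate scale bracket \<longleftrightarrow>
          leibniz_algebra.quasi_minimal_condition scale bracket)"
proof -
  interpret leibniz_algebra scale bracket by fact
  show ?thesis
    using quasi_Artinian_imp_product_chains_terminate product_chains_terminate_imp_quasi_Artinian
      quasi_Artinian_imp_quasi_minimal_condition quasi_minimal_condition_imp_quasi_Artinian
    by blast
qed

end
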